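(* Let $n\ge3$, let $B^{n-1}\times\mathbb{R}\subseteq\mathbb{R}^n$ be the open solid cylinder ($B^{n-1}$ the open unit ball of $\mathbb{R}^{n-1}$), and let $\Sigma_n=\{x\in\mathbb{R}^n:0<x_n<1\}$ be the open slab. Let $$\chi:\equiv\exists p_1\,\exists p_2\,\exists p_3\,\bigl(\neg\operatorname{Coll}(p_1,p_2,p_3)\wedge(\neg\varphi)^{\circ}(p_1,p_2,p_3)\bigr),$$ where $\varphi$ is the two-lines sentence and $(\cdot)^\circ$ denotes relativization to the planar section through $p_1,p_2,p_3$. Then $B^{n-1}\times\mathbb{R}\models\chi$ and $\Sigma_n\models\neg\chi$. In particular the open cylinder and the open slab are not elementarily equivalent in $\mathcal{L}_{\mathrm{B}}$.
   Context: $\mathcal{L}_{\mathrm{B}}$ is the first-order language with a single ternary relation symbol $B$; a convex set $K\subseteq\mathbb{R}^n$ is a structure with universe $K$, where $B(a,x,b)$ holds iff $x\in[a,b]$. $\operatorname{Coll}(x,y,z):\equiv B(x,y,z)\vee B(y,x,z)\vee B(x,z,y)$; $\operatorname{Meets}(a,b;c,d):\equiv\exists z\,(\operatorname{Coll}(a,b,z)\wedge\operatorname{Coll}(c,d,z))$. The two-lines sentence is $$\varphi:\ \exists a_1b_1a_2b_2\Bigl[a_1\ne b_1\wedge a_2\ne b_2\wedge\neg\operatorname{Meets}(a_1,b_1;a_2,b_2)\wedge\forall c\,d\Bigl(\bigl(c\ne d\wedge\neg(\operatorname{Coll}(a_1,b_1,c)\wedge\operatorname{Coll}(a_1,b_1,d))\wedge\neg(\operatorname{Coll}(a_2,b_2,c)\wedge\operatorname{Coll}(a_2,b_2,d))\bigr)\to\bigl(\operatorname{Meets}(c,d;a_1,b_1)\leftrightarrow\operatorname{Meets}(c,d;a_2,b_2)\bigr)\Bigr)\Bigr].$$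 $H_1(z;x_1):\equiv z=x_1$, $H_r(z;x_1,\dots,x_r):\equiv\exists w\,(H_{r-1}(w;x_2,\dots,x_r)\wedge B(x_1,z,w))$, and $\operatorname{Dep}_m(x_1,\dots,x_m):\equiv\bigvee_{\{1,\dots,m\}=I\sqcup J,\ I,J\ne\emptyset}\exists z\,(H_{|I|}(z;\bar x_I)\wedge H_{|J|}(z;\bar x_J))$. For a formula $\psi$, $\psi^\circ(\,\cdot\,;p_1,p_2,p_3)$ is obtained by relativizing every quantifier of $\psi$ to $\operatorname{Dep}_4(p_1,p_2,p_3,\cdot)$; for non-collinear $p_1,p_2,p_3\in K$ this formula defines the planar section $K\cap\operatorname{aff}\{p_1,p_2,p_3\}$, and $K\models\psi^\circ$ iff the section (as a structure) satisfies $\psi$. *)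

theory Defs
  imports "HOL-Analysis.Analysis"
begin

text \<open>
  Variables are de Bruijn indices: \<open>0\<close> refers to the innermost enclosing quantifier.
  In \<open>Btw a x b\<close> the middle argument is the point lying between the other two.
\<close>

datatype fm =
    Fls
  | Btw nat nat nat
  | Eq nat nat
  | Neg fm
  | And fm fm
  | Or fm fm
  | Imp fm fm
  | Iff fm fm
  | Ex fm
  | All fm

text \<open>Satisfaction in the structure with universe \<open>U\<close> and ternary relation \<open>R\<close>;
  the assignment \<open>e\<close> is a list, indexed by the free de Bruijn indices.\<close>

primrec sat :: "'a set \<Rightarrow> ('a \<Rightarrow> 'a \<Rightarrow> 'a \<Rightarrow> bool) \<Rightarrow> 'a list \<Rightarrow> fm \<Rightarrow> bool" where
  "sat U R e Fls \<longleftrightarrow> False"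
| "sat U R e (Btw x y z) \<longleftrightarrow> R (e ! x) (e ! y) (e ! z)"
| "sat U R e (Eq x y) \<longleftrightarrow> e ! x = e ! y"
| "sat U R e (Neg f) \<longleftrightarrow> \<not> sat U R e f"
| "sat U R e (And f g) \<longleftrightarrow> sat U R e f \<and> sat U R e g"
| "sat U R e (Or f g) \<longleftrightarrow> sat U R e f \<or> sat U R e g"
| "sat U R e (Imp f g) \<longleftrightarrow> (sat U R e f \<longrightarrow> sat U R e g)"
| "sat U R e (Iff f g) \<longleftrightarrow> (sat U R e f \<longleftrightarrow> sat U R e g)"
| "sat U R e (Ex f) \<longleftrightarrow> (\<exists>x\<in>U. sat U R (x # e) f)"
| "sat U R e (All f) \<longleftrightarrow> (\<forall>x\<in>U. sat U R (x # e) f)"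

text \<open>\<open>free_below k f\<close>: every free variable of \<open>f\<close> is among \<open>0, \<dots>, k - 1\<close>.\<close>

primrec free_below :: "nat \<Rightarrow> fm \<Rightarrow> bool" where
  "free_below k Fls \<longleftrightarrow> True"
| "free_below k (Btw x y z) \<longleftrightarrow> x < k \<and> y < k \<and> z < k"
| "free_below k (Eq x y) \<longleftrightarrow> x < k \<and> y < k"
| "free_below k (Neg f) \<longleftrightarrow> free_below k f"
| "free_below k (And f g) \<longleftrightarrow> free_below k f \<and> free_below k g"
| "free_below k (Or f g) \<longleftrightarrow> free_below k f \<and> free_below k g"
| "free_below k (Imp f g) \<longleftrightarrow> free_below k f \<and> free_below k g"
| "free_below k (Iff f g) \<longleftrightarrow> free_below k f \<and> free_below k g"
| "free_below k (Ex f) \<longleftrightarrow> free_below (Suc k) f"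
| "free_below k (All f) \<longleftrightarrow> free_below (Suc k) f"

definition sentence :: "fm \<Rightarrow> bool" where
  "sentence f \<longleftrightarrow> free_below 0 f"

text \<open>A (convex) set as a structure. This is meaningful only for sentences, which are evaluated
  under the empty assignment.\<close>

definition models :: "'a::real_vector set \<Rightarrow> fm \<Rightarrow> bool"  (infix "\<Turnstile>" 50) where
  "K \<Turnstile> f \<longleftrightarrow> sat K (\<lambda>a x b. x \<in> closed_segment a b) [] f"

definition elem_equiv :: "'a::real_vector set \<Rightarrow> 'b::real_vector set \<Rightarrow> bool" where
  "elem_equiv K L \<longleftrightarrow> (\<forall>f. sentence f \<longrightarrow> (K \<Turnstile> f \<longleftrightarrow> L \<Turnstile> f))"

definition Coll :: "nat \<Rightarrow> nat \<Rightarrow> nat \<Rightarrow> fm" where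
  "Coll x y z = Or (Btw x y z) (Or (Btw y x z) (Btw x z y))"

text \<open>Passing under a quantifier raises the index of every outer variable by one,
  whence the occurrences of \<open>Suc\<close> below.\<close>

definition Meets :: "nat \<Rightarrow> nat \<Rightarrow> nat \<Rightarrow> nat \<Rightarrow> fm" where
  "Meets a b c d = Ex (And (Coll (Suc a) (Suc b) 0) (Coll (Suc c) (Suc d) 0))"

text \<open>The two-lines sentence. Under the four existential quantifiers
  \<open>a\<^sub>1, b\<^sub>1, a\<^sub>2, b\<^sub>2\<close> are \<open>3, 2, 1, 0\<close>; under the two further universal quantifiers
  \<open>a\<^sub>1, b\<^sub>1, a\<^sub>2, b\<^sub>2, c, d\<close> are \<open>5, 4, 3, 2, 1, 0\<close>.\<close>

definition two_lines :: fm where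
  "two_lines =
     Ex (Ex (Ex (Ex
       (And (Neg (Eq 3 2))
       (And (Neg (Eq 1 0))
       (And (Neg (Meets 3 2 1 0))
         (All (All
           (Imp
             (And (Neg (Eq 1 0))
             (And (Neg (And (Coll 5 4 1) (Coll 5 4 0)))
                  (Neg (And (Coll 3 2 1) (Coll 3 2 0)))))
             (Iff (Meets 1 0 5 4) (Meets 1 0 3 2)))))))))))"

text \<open>\<open>Hull z [x\<^sub>1, \<dots>, x\<^sub>r]\<close> is \<open>H\<^sub>r(z; x\<^sub>1, \<dots>, x\<^sub>r)\<close>, only of interest for \<open>r \<ge> 1\<close>.\<close>

fun Hull :: "nat \<Rightarrow> nat list \<Rightarrow> fm" where
  "Hull z [] = Fls"
| "Hull z [x] = Eq z x"
| "Hull z (x # y # ys) = Ex (And (Hull 0 (map Suc (y # ys))) (Btw (Suc x) (Suc z) 0))"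

definition Disj :: "fm list \<Rightarrow> fm" where
  "Disj fs = foldr Or fs Fls"

text \<open>\<open>Dep [x\<^sub>1, \<dots>, x\<^sub>m]\<close>: the list \<open>I\<close> runs through the nonempty proper subsets of the
  index set, \<open>J\<close> being its complement.\<close>

definition Dep :: "nat list \<Rightarrow> fm" where
  "Dep xs =
     Disj (map (\<lambda>I. Ex (And (Hull 0 (map Suc (nths xs (set I))))
                            (Hull 0 (map Suc (nths xs (- set I))))))
       (filter (\<lambda>I. I \<noteq> [] \<and> length I < length xs) (subseqs [0..<length xs])))"

text \<open>Relativization of all quantifiers to \<open>Dep [p\<^sub>1, p\<^sub>2, p\<^sub>3, \<cdot>]\<close>. Here \<open>p\<^sub>1, p\<^sub>2, p\<^sub>3\<close> are
  indices in the context surrounding the formula.\<close>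

primrec relativize :: "nat \<Rightarrow> nat \<Rightarrow> nat \<Rightarrow> fm \<Rightarrow> fm" where
  "relativize p1 p2 p3 Fls = Fls"
| "relativize p1 p2 p3 (Btw x y z) = Btw x y z"
| "relativize p1 p2 p3 (Eq x y) = Eq x y"
| "relativize p1 p2 p3 (Neg f) = Neg (relativize p1 p2 p3 f)"
| "relativize p1 p2 p3 (And f g) = And (relativize p1 p2 p3 f) (relativize p1 p2 p3 g)"
| "relativize p1 p2 p3 (Or f g) = Or (relativize p1 p2 p3 f) (relativize p1 p2 p3 g)"
| "relativize p1 p2 p3 (Imp f g) = Imp (relativize p1 p2 p3 f) (relativize p1 p2 p3 g)"
| "relativize p1 p2 p3 (Iff f g) = Iff (relativize p1 p2 p3 f) (relativize p1 p2 p3 g)"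
| "relativize p1 p2 p3 (Ex f) =
     Ex (And (Dep [Suc p1, Suc p2, Suc p3, 0]) (relativize (Suc p1) (Suc p2) (Suc p3) f))"
| "relativize p1 p2 p3 (All f) =
     All (Imp (Dep [Suc p1, Suc p2, Suc p3, 0]) (relativize (Suc p1) (Suc p2) (Suc p3) f))"

text \<open>\<open>p\<^sub>1, p\<^sub>2, p\<^sub>3\<close> are the indices \<open>2, 1, 0\<close>.\<close>

definition chi :: fm where
  "chi = Ex (Ex (Ex (And (Neg (Coll 2 1 0)) (relativize 2 1 0 (Neg two_lines)))))"

text \<open>We write \<open>\<real>\<^sup>n\<close> as \<open>\<real>\<^sup>n\<^sup>-\<^sup>1 \<times> \<real>\<close>; thus \<open>n = CARD('m) + 1\<close> is the dimension of the ambient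
  type, and \<open>x\<^sub>n\<close> is \<open>snd x\<close>.\<close>

definition open_cylinder :: "((real ^ 'm) \<times> real) set" where
  "open_cylinder = ball 0 1 \<times> UNIV"

definition open_slab :: "((real ^ 'm) \<times> real) set" where
  "open_slab = {x. 0 < snd x \<and> snd x < 1}"

end

theory Submission
  imports Defs
begin

text \<open>By Radon's theorem \<open>Dep\<^sub>4\<close> with respect to three non-collinear points defines their affine hull,
  so \<open>chi\<close> says that some planar section violates the two-lines sentence. A planar section of the
  slab is a plane or a strip between parallel lines, where two parallel lines in a horizontal
  direction are witnesses. A horizontal section of the cylinder is bounded: through a point off a
  chord there are two different chords missing it, namely those ending where it ends, and so no
  chord is the only one to miss it.\<close>

abbreviation btw :: "'a::real_vector \<Rightarrow> 'a \<Rightarrow> 'a \<Rightarrow> bool" where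
  "btw a x b \<equiv> x \<in> closed_segment a b"

section \<open>Free variables: the separating formula is a sentence\<close>

lemma free_below_Hull:
  assumes "z < k" "set xs \<subseteq> {..<k}"
  shows "free_below k (Hull z xs)"
  using assms
proof (induction z xs arbitrary: k rule: Hull.induct)
  case (3 z x y ys)
  have "free_below (Suc k) (Hull 0 (map Suc (y # ys)))"
    using 3 by (intro "3.IH") auto
  with 3 show ?case by auto
qed auto

lemma free_below_Disj: "free_below k (Disj fs) \<longleftrightarrow> (\<forall>f\<in>set fs. free_below k f)"
  unfolding Disj_def by (induction fs) auto

lemma free_below_Dep:
  assumes "set xs \<subseteq> {..<k}"
  shows "free_below k (Dep xs)"
proof -
  have "free_below (Suc k) (Hull 0 (map Suc (nths xs J)))" for J
    by (rule free_below_Hull) (use assms in \<open>auto dest!: in_set_nthsD\<close>)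
  then show ?thesis
    by (auto simp: Dep_def free_below_Disj)
qed

text \<open>The guards added to the quantifiers mention the three parameters, so these must lie
  below \<open>k\<close> as well.\<close>

lemma free_below_relativize:
  assumes "free_below k f" "p1 < k" "p2 < k" "p3 < k"
  shows "free_below k (relativize p1 p2 p3 f)"
  using assms by (induction f arbitrary: k p1 p2 p3) (auto intro!: free_below_Dep)

text \<open>\<open>elem_equiv\<close> compares sentences only, so \<open>chi\<close> separates two
  structures only if it has no free variable.\<close>

lemma sentence_chi: "sentence chi"
proof -
  have "free_below 3 (Neg two_lines)"
    by (simp add: two_lines_def Meets_def Coll_def)
  then have "free_below 3 (relativize 2 1 0 (Neg two_lines))"
    by (rule free_below_relativize) auto
  then show ?thesis
    by (simp add: sentence_def chi_def Coll_def numeral_3_eq_3 numeral_2_eq_2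
        del: relativize.simps)
qed

section \<open>Convex hulls and Radon partitions as formulas\<close>

text \<open>Adding a point to a set turns its convex hull into the union of the segments from that
  point to the old hull. Convexity of \<open>K\<close> keeps the hull inside the universe, so the
  witness \<open>w\<close> can be any of its points.\<close>

lemma sat_Hull:
  assumes "convex K" "xs \<noteq> []" "\<forall>i\<in>set xs. e ! i \<in> K"
  shows "sat K btw e (Hull z xs) \<longleftrightarrow> e ! z \<in> convex hull ((!) e ` set xs)"
  using assms
proof (induction z xs arbitrary: e rule: Hull.induct)
  case (3 z x y ys)
  let ?H = "convex hull ((!) e ` set (y # ys))"
  have "sat K btw (w # e) (Hull 0 (map Suc (y # ys))) \<longleftrightarrow> w \<in> ?H" if "w \<in> K" for w
  proof -
    have "sat K btw (w # e) (Hull 0 (map Suc (y # ys))) \<longleftrightarrow>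
        (w # e) ! 0 \<in> convex hull ((!) (w # e) ` set (map Suc (y # ys)))"
      by (rule "3.IH") (use 3 in auto)
    then show ?thesis
      by (simp add: image_image)
  qed
  then have "sat K btw e (Hull z (x # y # ys)) \<longleftrightarrow>
      (\<exists>w\<in>K. w \<in> ?H \<and> e ! z \<in> closed_segment (e ! x) w)"
    by (auto simp del: list.map)
  also have "\<dots> \<longleftrightarrow> (\<exists>w\<in>?H. e ! z \<in> closed_segment (e ! x) w)"
  proof -
    have "?H \<subseteq> K"
      using 3 by (intro hull_minimal) auto
    then show ?thesis by blast
  qed
  also have "\<dots> \<longleftrightarrow> e ! z \<in> convex hull (insert (e ! x) ((!) e ` set (y # ys)))"
    by (subst convex_hull_insert_segments) auto
  finally show ?case by simp
qed auto

lemma sat_Disj: "sat U R e (Disj fs) \<longleftrightarrow> (\<exists>f\<in>set fs. sat U R e f)"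
  unfolding Disj_def by (induction fs) auto

text \<open>The partition splits indices, not points: \<open>g\<close> is a family, and equal points
  may fall on both sides.\<close>

lemma sat_Dep:
  fixes K :: "'a::real_vector set"
  assumes "convex K" "\<forall>i\<in>set xs. e ! i \<in> K"
  defines "N \<equiv> {..<length xs}" and "g \<equiv> \<lambda>i. e ! (xs ! i)"
  shows "sat K btw e (Dep xs) \<longleftrightarrow>
    (\<exists>I\<subseteq>N. I \<noteq> {} \<and> I \<noteq> N \<and> convex hull (g ` I) \<inter> convex hull (g ` (N - I)) \<noteq> {})"
proof -
  have hull: "sat K btw (z # e) (Hull 0 (map Suc (nths xs J))) \<longleftrightarrow> z \<in> convex hull (g ` (N \<inter> J))"
    if "z \<in> K" "N \<inter> J \<noteq> {}" for z J
  proof -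
    have *: "set (nths xs J) = (!) xs ` (N \<inter> J)"
      by (auto simp: set_nths N_def)
    have "sat K btw (z # e) (Hull 0 (map Suc (nths xs J))) \<longleftrightarrow>
        (z # e) ! 0 \<in> convex hull ((!) (z # e) ` set (map Suc (nths xs J)))"
      using assms that * by (intro sat_Hull) (auto dest!: in_set_nthsD)
    also have "(!) (z # e) ` set (map Suc (nths xs J)) = g ` (N \<inter> J)"
      by (simp add: image_image * g_def)
    finally show ?thesis by simp
  qed
  have inK: "convex hull (g ` I) \<subseteq> K" if "I \<subseteq> N" for I
    using assms that by (intro hull_minimal) auto
  have disj: "(\<exists>z\<in>K. sat K btw (z # e) (Hull 0 (map Suc (nths xs I))) \<and>
        sat K btw (z # e) (Hull 0 (map Suc (nths xs (- I))))) \<longleftrightarrow>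
      convex hull (g ` I) \<inter> convex hull (g ` (N - I)) \<noteq> {}"
    if "I \<subseteq> N" "I \<noteq> {}" "I \<noteq> N" for I
  proof -
    have *: "N \<inter> I = I" "N \<inter> - I = N - I" "N - I \<noteq> {}" using that by auto
    show ?thesis
      using hull[of _ I] hull[of _ "- I"] inK[of I] that * by auto
  qed
  \<comment> \<open>\<open>subseqs\<close> enumerates the subsets of \<open>N\<close> as lists.
    These have no repetitions, so being shorter than \<open>xs\<close> means being a proper
    subset.\<close>
  have lists: "I \<subseteq> N \<and> I \<noteq> {} \<and> I \<noteq> N \<longleftrightarrow>
      (\<exists>l\<in>set (subseqs [0..<length xs]). l \<noteq> [] \<and> length l < length xs \<and> set l = I)" for I
  proof -
    have len: "set l \<subseteq> N \<and> (length l < length xs \<longleftrightarrow> set l \<noteq> N)"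
      if "l \<in> set (subseqs [0..<length xs])" for l
    proof -
      have "set l \<in> set ` set (subseqs [0..<length xs])" using that by blast
      then have "set l \<subseteq> N" by (auto simp: subseqs_powset N_def)
      moreover have "card (set l) = length l"
        using subseqs_distinctD[OF that] by (simp add: distinct_card)
      moreover have "finite N" "card N = length xs" by (simp_all add: N_def)
      ultimately show ?thesis
        by (metis card_subset_eq nat_neq_iff order.strict_implies_order psubsetI psubset_card_mono)
    qed
    have "I \<subseteq> N \<longleftrightarrow> (\<exists>l\<in>set (subseqs [0..<length xs]). set l = I)"
    proof -
      have "I \<subseteq> N \<longleftrightarrow> I \<in> set ` set (subseqs [0..<length xs])"
        by (simp add: subseqs_powset N_def atLeast0LessThan)
      then show ?thesis by blast
    qed
    with len show ?thesis by fastforce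
  qed
  have "sat K btw e (Dep xs) \<longleftrightarrow>
    (\<exists>l\<in>set (subseqs [0..<length xs]). l \<noteq> [] \<and> length l < length xs \<and>
      (\<exists>z\<in>K. sat K btw (z # e) (Hull 0 (map Suc (nths xs (set l)))) \<and>
        sat K btw (z # e) (Hull 0 (map Suc (nths xs (- set l))))))"
    by (auto simp: Dep_def sat_Disj)
  also have "\<dots> \<longleftrightarrow> (\<exists>I. (\<exists>l\<in>set (subseqs [0..<length xs]). l \<noteq> [] \<and> length l < length xs \<and> set l = I) \<and>
      (\<exists>z\<in>K. sat K btw (z # e) (Hull 0 (map Suc (nths xs I))) \<and>
        sat K btw (z # e) (Hull 0 (map Suc (nths xs (- I))))))"
    by blast
  also have "\<dots> \<longleftrightarrow> (\<exists>I. (I \<subseteq> N \<and> I \<noteq> {} \<and> I \<noteq> N) \<and> convex hull (g ` I) \<inter> convex hull (g ` (N - I)) \<noteq> {})"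
    unfolding lists[symmetric] by (intro ex_cong1 conj_cong refl disj) auto
  finally show ?thesis by blast
qed

text \<open>Disjoint subsets of an affinely independent set have disjoint affine hulls, hence
  disjoint convex hulls. Conversely, dependence gives a partition by Radon's theorem, and a repeated
  value gives one by splitting off a single index.\<close>

lemma Radon_family:
  fixes f :: "'i \<Rightarrow> 'a::euclidean_space"
  assumes "finite N"
  shows "(\<exists>I\<subseteq>N. I \<noteq> {} \<and> I \<noteq> N \<and> convex hull (f ` I) \<inter> convex hull (f ` (N - I)) \<noteq> {}) \<longleftrightarrow>
    \<not> inj_on f N \<or> affine_dependent (f ` N)"  (is "?L \<longleftrightarrow> ?R")
proof
  show ?R if L: ?L
  proof (rule ccontr)
    assume "\<not> ?R"
    then have inj: "inj_on f N" and indep: "\<not> affine_dependent (f ` N)" by auto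
    obtain I where I: "I \<subseteq> N" and ne: "convex hull (f ` I) \<inter> convex hull (f ` (N - I)) \<noteq> {}"
      using L by blast
    have "f ` I \<inter> f ` (N - I) = {}"
      using inj I by (auto simp: inj_on_def)
    then have "affine hull (f ` I) \<inter> affine hull (f ` (N - I)) = {}"
      using I by (intro disjoint_affine_hull[OF indep]) auto
    with ne show False
      using convex_hull_subset_affine_hull by blast
  qed
  show ?L if R: ?R
  proof (cases "inj_on f N")
    case True
    with R have "affine_dependent (f ` N)" by simp
    then obtain M P where MP: "M \<subseteq> f ` N" "P \<subseteq> f ` N" "M \<inter> P = {}"
      and ne: "convex hull M \<inter> convex hull P \<noteq> {}"
      by (rule Radon)
    \<comment> \<open>\<open>M\<close> and \<open>P\<close> are disjoint, so every index with a
      value in \<open>P\<close> falls into the complement of \<open>I\<close>; the leftover indices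
      only enlarge that side.\<close>
    define I where "I = {i\<in>N. f i \<in> M}"
    have "f ` I = M" "P \<subseteq> f ` (N - I)"
      using MP unfolding I_def by blast+
    moreover from this have "convex hull P \<subseteq> convex hull (f ` (N - I))"
      by (intro hull_mono)
    moreover have "M \<noteq> {}" "P \<noteq> {}" using ne by auto
    ultimately show ?L
      using ne by (intro exI[of _ I]) (auto simp: I_def)
  next
    case False
    then obtain i j where ij: "i \<in> N" "j \<in> N" "i \<noteq> j" "f i = f j"
      by (auto simp: inj_on_def)
    then have "f i \<in> convex hull (f ` (N - {i}))"
      by (intro hull_inc) auto
    with ij show ?L
      by (intro exI[of _ "{i}"]) auto
  qed
qed

section \<open>Relativization to planar sections\<close>

lemma sat_Dep4:
  fixes K :: "'a::euclidean_space set"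
  assumes "convex K" "e ! p1 \<in> K" "e ! p2 \<in> K" "e ! p3 \<in> K" "x \<in> K"
    and nc: "\<not> collinear {e ! p1, e ! p2, e ! p3}"
  shows "sat K btw (x # e) (Dep [Suc p1, Suc p2, Suc p3, 0]) \<longleftrightarrow>
    x \<in> affine hull {e ! p1, e ! p2, e ! p3}"
proof -
  let ?xs = "[Suc p1, Suc p2, Suc p3, 0]"
  let ?P = "{e ! p1, e ! p2, e ! p3}"
  define g where "g = (\<lambda>i. (x # e) ! (?xs ! i))"
  have N: "{..<4} = {0, 1, 2, 3::nat}" by auto
  have g: "g 0 = e ! p1" "g 1 = e ! p2" "g 2 = e ! p3" "g 3 = x"
    by (simp_all add: g_def)
  have dist: "e ! p1 \<noteq> e ! p2" "e ! p1 \<noteq> e ! p3" "e ! p2 \<noteq> e ! p3"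
    and indep: "\<not> affine_dependent ?P"
    using nc by (auto simp: collinear_3_eq_affine_dependent)
  have len: "length ?xs = 4" by simp
  have "sat K btw (x # e) (Dep ?xs) \<longleftrightarrow> (\<exists>I\<subseteq>{..<4}. I \<noteq> {} \<and> I \<noteq> {..<4} \<and>
      convex hull (g ` I) \<inter> convex hull (g ` ({..<4} - I)) \<noteq> {})"
    using sat_Dep[of K ?xs "x # e"] assms unfolding g_def len by simp
  also have "\<dots> \<longleftrightarrow> \<not> inj_on g {..<4} \<or> affine_dependent (g ` {..<4})"
    by (rule Radon_family) simp
  \<comment> \<open>When \<open>x\<close> is one of the three points, \<open>insert x ?P\<close> is
    still independent; the failure of injectivity accounts for this case.\<close>
  also have "\<dots> \<longleftrightarrow> x \<in> ?P \<or> affine_dependent (insert x ?P)"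
  proof -
    have "g ` {..<4} = insert x ?P"
      unfolding N by (simp only: image_insert image_empty g) blast
    moreover have "inj_on g {..<4} \<longleftrightarrow> x \<notin> ?P"
      unfolding N using dist g by (simp add: inj_on_def) metis
    ultimately show ?thesis by simp
  qed
  also have "\<dots> \<longleftrightarrow> x \<in> affine hull ?P"
  proof (cases "x \<in> ?P")
    case False
    then show ?thesis
      using affine_dependent_choose[OF indep] by blast
  qed (simp add: hull_inc)
  finally show ?thesis .
qed

text \<open>By \<open>sat_Dep4\<close> each guard cuts the universe down to the section. Pushing a
  variable onto \<open>e\<close> keeps the values of the parameters, whose indices are raised along
  with it.\<close>

lemma sat_relativize:
  fixes K :: "'a::euclidean_space set"
  assumes "convex K" "e ! p1 \<in> K" "e ! p2 \<in> K" "e ! p3 \<in> K"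
    and "\<not> collinear {e ! p1, e ! p2, e ! p3}"
  shows "sat K btw e (relativize p1 p2 p3 f) \<longleftrightarrow>
    sat (K \<inter> affine hull {e ! p1, e ! p2, e ! p3}) btw e f"
  using assms
proof (induction f arbitrary: e p1 p2 p3)
  case (Ex f)
  have "sat K btw (x # e) (relativize (Suc p1) (Suc p2) (Suc p3) f) \<longleftrightarrow>
    sat (K \<inter> affine hull {e ! p1, e ! p2, e ! p3}) btw (x # e) f" for x
    using Ex.IH[of "x # e" "Suc p1" "Suc p2" "Suc p3"] Ex.prems by simp
  then show ?case
    using sat_Dep4[OF Ex.prems(1-4) _ Ex.prems(5)] by auto
next
  case (All f)
  have "sat K btw (x # e) (relativize (Suc p1) (Suc p2) (Suc p3) f) \<longleftrightarrow>
    sat (K \<inter> affine hull {e ! p1, e ! p2, e ! p3}) btw (x # e) f" for x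
    using All.IH[of "x # e" "Suc p1" "Suc p2" "Suc p3"] All.prems by simp
  then show ?case
    using sat_Dep4[OF All.prems(1-4) _ All.prems(5)] by auto
qed auto

section \<open>Geometric reading of the two-lines sentence\<close>

lemma sat_Coll:
  fixes U :: "'a::euclidean_space set"
  shows "sat U btw e (Coll x y z) \<longleftrightarrow> collinear {e ! x, e ! y, e ! z}"
  by (auto simp: Coll_def collinear_between_cases between_mem_segment closed_segment_commute)

text \<open>Lines are affine hulls of two points, but they count as meeting only if they share a
  point of \<open>S\<close>.\<close>

definition two_lines_in :: "'a::real_vector set \<Rightarrow> bool" where
  "two_lines_in S \<longleftrightarrow> (\<exists>a1\<in>S. \<exists>b1\<in>S. \<exists>a2\<in>S. \<exists>b2\<in>S. a1 \<noteq> b1 \<and> a2 \<noteq> b2 \<and>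
    S \<inter> affine hull {a1, b1} \<inter> affine hull {a2, b2} = {} \<and>
    (\<forall>c\<in>S. \<forall>d\<in>S. c \<noteq> d \<longrightarrow> \<not> {c, d} \<subseteq> affine hull {a1, b1} \<longrightarrow> \<not> {c, d} \<subseteq> affine hull {a2, b2} \<longrightarrow>
      (S \<inter> affine hull {c, d} \<inter> affine hull {a1, b1} = {} \<longleftrightarrow>
       S \<inter> affine hull {c, d} \<inter> affine hull {a2, b2} = {})))"

lemma sat_two_lines:
  fixes S :: "'a::euclidean_space set"
  shows "sat S btw e two_lines \<longleftrightarrow> two_lines_in S"
proof -
  define meets where "meets a b c d \<longleftrightarrow> S \<inter> affine hull {a, b} \<inter> affine hull {c, d} \<noteq> {}" for a b c d
  \<comment> \<open>Distinctness is essential: for \<open>a = b\<close> every \<open>z\<close> is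
    collinear with \<open>a\<close> and \<open>b\<close>, while the affine hull is one point. The
    congruence rules below supply it from the earlier conjuncts and premises.\<close>
  have "(\<exists>z\<in>S. collinear {a, b, z} \<and> collinear {c, d, z}) \<longleftrightarrow> meets a b c d"
    if "a \<noteq> b" "c \<noteq> d" for a b c d
    using that by (auto simp: meets_def collinear_3_affine_hull)
  moreover have "S \<inter> affine hull {a, b} \<inter> affine hull {c, d} = {} \<longleftrightarrow> \<not> meets a b c d" for a b c d
    by (simp add: meets_def)
  ultimately show ?thesis
    unfolding two_lines_in_def two_lines_def
    by (simp add: Meets_def sat_Coll collinear_3_affine_hull imp_conjL cong: conj_cong imp_cong)
qed

lemma chi_iff:
  fixes K :: "'a::euclidean_space set"
  assumes "convex K"
  shows "K \<Turnstile> chi \<longleftrightarrow> (\<exists>p\<in>K. \<exists>q\<in>K. \<exists>r\<in>K. \<not> collinear {p, q, r} \<and>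
    \<not> two_lines_in (K \<inter> affine hull {p, q, r}))"
proof -
  \<comment> \<open>The innermost quantifier binds \<open>r\<close>, which therefore comes first in
    the assignment.\<close>
  have "sat K btw [r, q, p] (relativize 2 1 0 (Neg two_lines)) \<longleftrightarrow>
      \<not> two_lines_in (K \<inter> affine hull {p, q, r})"
    if "p \<in> K" "q \<in> K" "r \<in> K" "\<not> collinear {p, q, r}" for p q r
    using sat_relativize[of K "[r, q, p]" 2 1 0 "Neg two_lines"] that assms
    by (simp add: sat_two_lines)
  then show ?thesis
    by (auto simp: models_def chi_def sat_Coll simp del: relativize.simps cong: conj_cong)
qed

section \<open>Sections of bounded open convex sets\<close>

text \<open>Any two distinct points of a line span it. This is used to conclude that two lines with
  two common points coincide.\<close>

lemma in_affine_hull_2_exchange: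
  fixes a b x y :: "'a::real_vector"
  assumes "x \<in> affine hull {a, b}" "y \<in> affine hull {a, b}" "x \<noteq> y"
  shows "a \<in> affine hull {x, y}"
proof -
  obtain s t where x: "x = a + s *\<^sub>R (b - a)" and y: "y = a + t *\<^sub>R (b - a)"
    using assms(1,2) by (auto simp: affine_hull_2_alt)
  with assms(3) have "s - t \<noteq> 0" by auto
  \<comment> \<open>On the line, \<open>x\<close> has parameter \<open>s\<close>, \<open>y\<close>
    has \<open>t\<close> and \<open>a\<close> has 0; the coefficient solves
    \<open>s + k * (t - s) = 0\<close> for \<open>k\<close>.\<close>
  have "x + (s / (s - t)) *\<^sub>R (y - x) = a + (s + s / (s - t) * (t - s)) *\<^sub>R (b - a)"
    by (simp add: x y flip: scaleR_diff_left) (simp add: scaleR_add_left)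
  also have "s + s / (s - t) * (t - s) = 0"
    using \<open>s - t \<noteq> 0\<close> by (simp add: field_simps)
  finally show ?thesis
    by (auto simp: affine_hull_2_alt intro: range_eqI[OF sym])
qed

text \<open>The second line has two distinct end points \<open>e\<close>, \<open>f\<close> outside \<open>K\<close>. The lines joining
  \<open>a1\<close> to \<open>e\<close> and to \<open>f\<close> avoid the second line inside \<open>K\<close>, and at most one of them can be the
  first line.\<close>

lemma bounded_section_not_two_lines_in:
  fixes K :: "'a::euclidean_space set"
  assumes "open K" "convex K" "bounded K" "affine A"
  shows "\<not> two_lines_in (K \<inter> A)"
proof
  assume "two_lines_in (K \<inter> A)"
  then obtain a1 b1 a2 b2 where in_S: "a1 \<in> K" "a1 \<in> A" "b1 \<in> K" "b1 \<in> A" "a2 \<in> K" "a2 \<in> A" "b2 \<in> K" "b2 \<in> A"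
    and ne: "a1 \<noteq> b1" "a2 \<noteq> b2"
    and disj: "K \<inter> A \<inter> affine hull {a1, b1} \<inter> affine hull {a2, b2} = {}"
    and par: "\<And>c d. c \<in> K \<inter> A \<Longrightarrow> d \<in> K \<inter> A \<Longrightarrow> c \<noteq> d \<Longrightarrow>
      \<not> {c, d} \<subseteq> affine hull {a1, b1} \<Longrightarrow> \<not> {c, d} \<subseteq> affine hull {a2, b2} \<Longrightarrow>
      (K \<inter> A \<inter> affine hull {c, d} \<inter> affine hull {a1, b1} = {} \<longleftrightarrow>
       K \<inter> A \<inter> affine hull {c, d} \<inter> affine hull {a2, b2} = {})"
    unfolding two_lines_in_def by (elim bexE conjE) (auto 0 3)
  have int: "interior K = K" using \<open>open K\<close> by (simp add: interior_open)
  have a1: "a1 \<notin> affine hull {a2, b2}"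
    using disj in_S hull_inc[of a1 "{a1, b1}" affine] by blast
  have endpoint: "e \<in> affine hull {a1, b1}"
    if e: "e \<in> frontier K" "e \<in> affine hull {a2, b2}" for e
  proof (rule ccontr)
    assume e1: "e \<notin> affine hull {a1, b1}"
    have eK: "e \<in> closure K" "e \<notin> K"
      using e int by (auto simp: frontier_def)
    have eA: "e \<in> A"
      using e(2) hull_minimal[of "{a2, b2}" A affine] in_S assms by auto
    have "a1 \<noteq> e" using eK in_S by auto
    \<comment> \<open>The end point \<open>e\<close> lies outside \<open>K\<close>, so the line from
      \<open>a1\<close> to \<open>e\<close> needs another point of \<open>K\<close> to be named in
      \<open>par\<close>.\<close>
    define d where "d = midpoint a1 e"
    have "d \<in> K"
      using in_interior_closure_convex_segment[OF \<open>convex K\<close>, of a1 e] int in_S eK \<open>a1 \<noteq> e\<close>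
      by (auto simp: d_def)
    have e_line: "e \<in> affine hull {a1, d}"
      unfolding affine_hull_2_alt by (rule range_eqI[of _ _ 2])
        (simp add: d_def midpoint_def algebra_simps scaleR_2)
    have "d \<in> affine hull {a1, e}"
      by (auto simp: d_def affine_hull_2_alt midpoint_def algebra_simps intro!: range_eqI[of _ _ "1/2"])
        (metis add.commute field_sum_of_halves scaleR_add_left scaleR_one)
    then have "d \<in> A"
      using hull_minimal[of "{a1, e}" A affine] in_S eA assms by auto
    have "a1 \<noteq> d" using \<open>a1 \<noteq> e\<close> by (metis d_def midpoint_eq_endpoint(1))
    have "d \<notin> affine hull {a1, b1}"
      using e1 e_line hull_minimal[of "{a1, d}" "affine hull {a1, b1}" affine]
        hull_inc[of a1 "{a1, b1}" affine] by auto
    moreover have "a1 \<in> K \<inter> A \<inter> affine hull {a1, d} \<inter> affine hull {a1, b1}"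
      using in_S by (simp add: hull_inc)
    \<comment> \<open>The line through \<open>a1\<close> and \<open>d\<close> meets the first line
      at \<open>a1\<close>, so \<open>par\<close> makes it meet the second line inside
      \<open>K\<close>.\<close>
    ultimately obtain z where z: "z \<in> K" "z \<in> affine hull {a1, d}" "z \<in> affine hull {a2, b2}"
      using par[of a1 d] in_S \<open>d \<in> K\<close> \<open>d \<in> A\<close> \<open>a1 \<noteq> d\<close> a1 by auto
    \<comment> \<open>\<open>z\<close> and \<open>e\<close> are two common points of this line and
      the second line, which forces \<open>a1\<close> onto the second line.\<close>
    have "z \<noteq> e" using z eK by auto
    then have "a1 \<in> affine hull {z, e}"
      using in_affine_hull_2_exchange[OF z(2) e_line] by simp
    then show False
      using a1 z e hull_minimal[of "{z, e}" "affine hull {a2, b2}" affine] by auto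
  qed
  have ray: "\<exists>d>0. a2 + d *\<^sub>R l \<in> frontier K" if "l \<noteq> 0" for l
    using ray_to_frontier[OF \<open>bounded K\<close>, of a2 l] int in_S that by metis
  \<comment> \<open>Starting at \<open>a2\<close>, the second line leaves the bounded set
    \<open>K\<close> in both directions, at parameters \<open>s\<close> and
    \<open>-t\<close>.\<close>
  obtain s t where s: "0 < s" "a2 + s *\<^sub>R (b2 - a2) \<in> frontier K"
    and t: "0 < t" "a2 + t *\<^sub>R (- (b2 - a2)) \<in> frontier K"
    using ray[of "b2 - a2"] ray[of "- (b2 - a2)"] ne by auto
  define e where "e = a2 + s *\<^sub>R (b2 - a2)"
  define f where "f = a2 + (- t) *\<^sub>R (b2 - a2)"
  have ef: "e \<in> affine hull {a2, b2}" "f \<in> affine hull {a2, b2}"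
    unfolding affine_hull_2_alt e_def f_def by blast+
  have "e - f = (s + t) *\<^sub>R (b2 - a2)"
    by (simp add: e_def f_def algebra_simps)
  then have "e \<noteq> f"
    using s t ne by auto
  have "f = a2 + t *\<^sub>R (- (b2 - a2))" unfolding f_def by (metis scaleR_minus_left scaleR_minus_right)
  then have "e \<in> affine hull {a1, b1}" "f \<in> affine hull {a1, b1}"
    using endpoint ef s t by (auto simp: e_def)
  then have "a1 \<in> affine hull {e, f}"
    using in_affine_hull_2_exchange \<open>e \<noteq> f\<close> by blast
  then show False
    using a1 ef hull_minimal[of "{e, f}" "affine hull {a2, b2}" affine] by auto
qed

section \<open>Strips between parallel lines\<close>

text \<open>The lines \<open>t = t1\<close> and \<open>t = t2\<close> are parallel to the strip, and any other line in the
  strip is either parallel to both or crosses both.\<close>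

lemma strip_two_lines_in:
  fixes p u r :: "'a::real_vector"
  assumes indep: "\<And>s t. s *\<^sub>R u + t *\<^sub>R r = 0 \<Longrightarrow> s = 0 \<and> t = 0"
    and T: "t1 \<in> T" "t2 \<in> T" "t1 \<noteq> t2"
  shows "two_lines_in {p + s *\<^sub>R u + t *\<^sub>R r |s t. t \<in> T}" (is "two_lines_in ?S")
proof -
  define P where "P s t = p + s *\<^sub>R u + t *\<^sub>R r" for s t
  have S: "?S = {P s t |s t. t \<in> T}" by (simp add: P_def)
  have P_eq: "P s t = P s' t' \<longleftrightarrow> s = s' \<and> t = t'" for s t s' t'
  proof
    assume "P s t = P s' t'"
    then have "(s - s') *\<^sub>R u + (t - t') *\<^sub>R r = 0"
      by (simp add: P_def algebra_simps)
    with indep show "s = s' \<and> t = t'" by fastforce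
  qed simp
  have line: "affine hull {P s t, P s' t'} = {P (s + k * (s' - s)) (t + k * (t' - t)) |k. True}" for s t s' t'
  proof -
    have "P s t + k *\<^sub>R (P s' t' - P s t) = P (s + k * (s' - s)) (t + k * (t' - t))" for k
      by (simp add: P_def algebra_simps)
    then show ?thesis by (auto simp: affine_hull_2_alt)
  qed
  have hor: "affine hull {P 0 t, P 1 t} = {P s t |s. True}" for t
    by (auto simp: line)
  \<comment> \<open>The criterion \<open>t = t'\<close> does not mention \<open>t0\<close>, so it
    yields the same answer for both lines.\<close>
  have meet: "?S \<inter> affine hull {P s t, P s' t'} \<inter> affine hull {P 0 t0, P 1 t0} = {} \<longleftrightarrow> t = t'"
    if "t0 \<in> T" "\<not> {P s t, P s' t'} \<subseteq> affine hull {P 0 t0, P 1 t0}" for s t s' t' t0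
  proof (cases "t = t'")
    case True
    then have "t \<noteq> t0"
      using that by (auto simp: hor)
    with True show ?thesis
      by (auto simp: hor line P_eq)
  next
    case False
    \<comment> \<open>Parameter at which the line through the two points reaches height
      \<open>t0\<close>; the crossing point stays in the strip because \<open>s\<close> is
      unrestricted.\<close>
    define k where "k = (t0 - t) / (t' - t)"
    have "t + k * (t' - t) = t0" using False by (simp add: k_def)
    then have "P (s + k * (s' - s)) t0 \<in> affine hull {P s t, P s' t'}"
      unfolding line by blast
    then have "P (s + k * (s' - s)) t0 \<in> ?S \<inter> affine hull {P s t, P s' t'} \<inter> affine hull {P 0 t0, P 1 t0}"
      using that by (auto simp: hor S)
    with False show ?thesis by blast
  qed
  have in_S: "P s t \<in> ?S" if "t \<in> T" for s t
    using that by (auto simp: S)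
  have ne: "P 0 t \<noteq> P 1 t" for t
    by (simp add: P_eq)
  have disj: "?S \<inter> affine hull {P 0 t1, P 1 t1} \<inter> affine hull {P 0 t2, P 1 t2} = {}"
    using T by (auto simp: hor P_eq)
  have par: "?S \<inter> affine hull {c, d} \<inter> affine hull {P 0 t1, P 1 t1} = {} \<longleftrightarrow>
       ?S \<inter> affine hull {c, d} \<inter> affine hull {P 0 t2, P 1 t2} = {}"
    if cd: "c \<in> ?S" "d \<in> ?S" "\<not> {c, d} \<subseteq> affine hull {P 0 t1, P 1 t1}"
      "\<not> {c, d} \<subseteq> affine hull {P 0 t2, P 1 t2}" for c d
  proof -
    obtain s t s' t' where "c = P s t" "d = P s' t'"
      using cd(1,2) unfolding S by blast
    with cd(3,4) show ?thesis
      using meet T by simp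
  qed
  show ?thesis
    unfolding two_lines_in_def
    by (rule bexI[of _ "P 0 t1"], rule bexI[of _ "P 1 t1"], rule bexI[of _ "P 0 t2"],
        rule bexI[of _ "P 1 t2"]) (intro conjI ballI impI ne disj par in_S T; assumption)+
qed

section \<open>Sections of the slab and of the cylinder\<close>

lemma convex_open_cylinder: "convex (open_cylinder :: ((real ^ 'm) \<times> real) set)"
  unfolding open_cylinder_def by (intro convex_Times) auto

lemma convex_open_slab: "convex (open_slab :: ((real ^ 'm) \<times> real) set)"
proof -
  have *: "(open_slab :: ((real ^ 'm) \<times> real) set) = snd -` {0<..<1}"
    by (auto simp: open_slab_def)
  show ?thesis
    unfolding * by (intro convex_linear_vimage linear_snd) simp
qed

text \<open>The linear map \<open>snd\<close> vanishes on some nonzero direction \<open>u\<close> of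
  the plane. In coordinates along \<open>u\<close> and a second direction \<open>r\<close>, the slab
  restricts only the coefficient of \<open>r\<close>.\<close>

lemma slab_section_two_lines_in:
  fixes p1 p2 p3 :: "(real ^ 'm) \<times> real"
  assumes K: "p1 \<in> open_slab" "p2 \<in> open_slab" "p3 \<in> open_slab"
    and nc: "\<not> collinear {p1, p2, p3}"
  shows "two_lines_in (open_slab \<inter> affine hull {p1, p2, p3})"
proof -
  define v where "v = p2 - p1"
  define w where "w = p3 - p1"
  have hull: "affine hull {p1, p2, p3} = {p1 + s *\<^sub>R v + t *\<^sub>R w |s t. True}"
  proof -
    have "(\<exists>a b c. x = a *\<^sub>R p1 + b *\<^sub>R p2 + c *\<^sub>R p3 \<and> a + b + c = 1) \<longleftrightarrow>
      (\<exists>s t. x = p1 + s *\<^sub>R v + t *\<^sub>R w)" for x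
    proof
      assume "\<exists>a b c. x = a *\<^sub>R p1 + b *\<^sub>R p2 + c *\<^sub>R p3 \<and> a + b + c = 1"
      then obtain a b c where x: "x = a *\<^sub>R p1 + b *\<^sub>R p2 + c *\<^sub>R p3" and "a + b + c = 1" by blast
      then have "a = 1 - b - c" by simp
      with x have "x = p1 + b *\<^sub>R v + c *\<^sub>R w" by (simp add: v_def w_def algebra_simps)
      then show "\<exists>s t. x = p1 + s *\<^sub>R v + t *\<^sub>R w" by blast
    next
      assume "\<exists>s t. x = p1 + s *\<^sub>R v + t *\<^sub>R w"
      then obtain s t where "x = p1 + s *\<^sub>R v + t *\<^sub>R w" by blast
      then have "x = (1 - s - t) *\<^sub>R p1 + s *\<^sub>R p2 + t *\<^sub>R p3"
        by (simp add: v_def w_def algebra_simps)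
      moreover have "(1 - s - t) + s + t = 1" by simp
      ultimately show "\<exists>a b c. x = a *\<^sub>R p1 + b *\<^sub>R p2 + c *\<^sub>R p3 \<and> a + b + c = 1" by blast
    qed
    then show ?thesis by (auto simp: affine_hull_3)
  qed
  have indep: "s = 0 \<and> t = 0" if "s *\<^sub>R v + t *\<^sub>R w = 0" for s t
  proof (rule ccontr)
    assume st: "\<not> (s = 0 \<and> t = 0)"
    have "collinear {0, v, w}"
    proof (cases "s = 0")
      case True
      with st that have "w = 0" by auto
      then show ?thesis by (simp add: insert_commute)
    next
      case False
      have "s *\<^sub>R v = - t *\<^sub>R w" using that by (simp add: eq_neg_iff_add_eq_0)
      then have "v = (- t / s) *\<^sub>R w"
        using False by (metis divide_inverse_commute scaleR_one scaleR_scaleR left_inverse)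
      then have "collinear {0, w, v}" by (metis collinear_lemma)
      then show ?thesis by (simp add: insert_commute)
    qed
    \<comment> \<open>\<open>collinear_3\<close> takes the middle point as origin, hence the
      order.\<close>
    then have "collinear {p2, p1, p3}"
      by (simp add: collinear_3[of p2 p1 p3] v_def w_def)
    with nc show False by (simp add: insert_commute)
  qed
  \<comment> \<open>The point \<open>p1 + r\<close> will be \<open>p3\<close> or \<open>p2\<close>,
    so the heights of \<open>p1\<close> and \<open>p1 + r\<close> provide the parameters 0 and 1 of
    the two parallel lines.\<close>
  obtain u r where snd_u: "snd u = 0" and r: "p1 + r \<in> open_slab"
    and indep': "\<And>s t. s *\<^sub>R u + t *\<^sub>R r = 0 \<Longrightarrow> s = 0 \<and> t = 0"
    and hull': "affine hull {p1, p2, p3} = {p1 + s *\<^sub>R u + t *\<^sub>R r |s t. True}"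
  proof (cases "snd v = 0")
    case True
    then show ?thesis
      using that[of v w] indep hull K by (simp add: w_def)
  next
    case False
    \<comment> \<open>The combination of \<open>v\<close> and \<open>w\<close> whose last
      coordinates cancel; as \<open>snd v\<close> is nonzero, \<open>w\<close> can be recovered from
      \<open>u\<close> and \<open>v\<close>.\<close>
    define u where "u = snd v *\<^sub>R w - snd w *\<^sub>R v"
    have comb: "s *\<^sub>R u + t *\<^sub>R v = (t - s * snd w) *\<^sub>R v + (s * snd v) *\<^sub>R w" for s t
      by (simp add: u_def algebra_simps)
    have "s = 0 \<and> t = 0" if "s *\<^sub>R u + t *\<^sub>R v = 0" for s t
      using indep[of "t - s * snd w" "s * snd v"] that False unfolding comb by simp
    moreover have "affine hull {p1, p2, p3} = {p1 + s *\<^sub>R u + t *\<^sub>R v |s t. True}"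
    proof -
      have "s *\<^sub>R v + t *\<^sub>R w = (t / snd v) *\<^sub>R u + (s + t / snd v * snd w) *\<^sub>R v" for s t
        unfolding comb using False by simp
      then have "p1 + s *\<^sub>R v + t *\<^sub>R w = p1 + (t / snd v) *\<^sub>R u + (s + t / snd v * snd w) *\<^sub>R v" for s t
        by (simp add: add.assoc)
      moreover have "p1 + s *\<^sub>R u + t *\<^sub>R v = p1 + (t - s * snd w) *\<^sub>R v + (s * snd v) *\<^sub>R w" for s t
        using comb by (simp add: add.assoc)
      ultimately show ?thesis
        unfolding hull by blast
    qed
    moreover have "snd u = 0" by (simp add: u_def)
    ultimately show ?thesis
      using that[of u v] K by (simp add: v_def)
  qed
  define T where "T = {t. 0 < snd p1 + t * snd r \<and> snd p1 + t * snd r < 1}"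
  have "open_slab \<inter> affine hull {p1, p2, p3} = {p1 + s *\<^sub>R u + t *\<^sub>R r |s t. t \<in> T}"
    unfolding hull' by (fastforce simp: open_slab_def T_def snd_u)
  moreover have "0 \<in> T" "1 \<in> T"
    using K r by (auto simp: T_def open_slab_def)
  ultimately show ?thesis
    using strip_two_lines_in[OF indep', where ?t1.0 = 0 and ?t2.0 = 1 and T = T and p = p1] by simp
qed

lemma open_slab_not_chi: "\<not> (open_slab :: ((real ^ 'm) \<times> real) set) \<Turnstile> chi"
  using slab_section_two_lines_in unfolding chi_iff[OF convex_open_slab] by blast

text \<open>Two coordinate axes of the ball factor span a plane at height 0, which cuts the cylinder
  in a disc.\<close>

lemma open_cylinder_chi:
  assumes "CARD('m) \<ge> 2"
  shows "(open_cylinder :: ((real ^ 'm) \<times> real) set) \<Turnstile> chi"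
proof -
  obtain i j :: 'm where "i \<noteq> j"
    using assms by (metis One_nat_def card_2_iff' numeral_2_eq_2 ex_card UNIV_I)
  define p :: "(real ^ 'm) \<times> real" where "p = ((1/2) *\<^sub>R axis i 1, 0)"
  define q :: "(real ^ 'm) \<times> real" where "q = ((1/2) *\<^sub>R axis j 1, 0)"
  have "\<not> collinear {0, p, q}"
  proof
    assume "collinear {0, p, q}"
    moreover have "p \<noteq> 0" "q \<noteq> 0" by (simp_all add: p_def q_def zero_prod_def axis_eq_0_iff)
    ultimately obtain c where "q = c *\<^sub>R p" by (auto simp: collinear_lemma)
    then have "((1/2) *\<^sub>R axis j 1 :: real ^ 'm) $ j = (c *\<^sub>R (1/2) *\<^sub>R axis i 1 :: real ^ 'm) $ j"
      by (simp add: p_def q_def)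
    with \<open>i \<noteq> j\<close> show False by (simp add: axis_def)
  qed
  moreover have "p \<in> open_cylinder" "q \<in> open_cylinder" "0 \<in> (open_cylinder :: ((real ^ 'm) \<times> real) set)"
    by (auto simp: p_def q_def open_cylinder_def zero_prod_def)
  \<comment> \<open>The cylinder is unbounded; rewriting the section as one of the unit ball makes
    \<open>bounded_section_not_two_lines_in\<close> applicable.\<close>
  moreover have "open_cylinder \<inter> affine hull {0, p, q} = ball 0 1 \<inter> affine hull {0, p, q}"
  proof -
    have "affine hull {0, p, q} \<subseteq> {x. snd x = 0}"
      by (intro hull_minimal) (auto simp: p_def q_def affine_def)
    moreover have "x \<in> open_cylinder \<longleftrightarrow> x \<in> ball 0 1" if "snd x = 0" for x :: "(real ^ 'm) \<times> real"
      using that by (cases x) (simp add: open_cylinder_def norm_Pair)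
    ultimately show ?thesis
      by blast
  qed
  moreover have "\<not> two_lines_in (ball 0 1 \<inter> affine hull {0, p, q})"
    by (intro bounded_section_not_two_lines_in) auto
  ultimately show ?thesis
    unfolding chi_iff[OF convex_open_cylinder] by metis
qed

theorem proposition10p13:
  assumes "DIM((real ^ 'm) \<times> real) \<ge> 3"
  shows "(open_cylinder :: ((real ^ 'm) \<times> real) set) \<Turnstile> chi
       \<and> (open_slab :: ((real ^ 'm) \<times> real) set) \<Turnstile> Neg chi
       \<and> \<not> elem_equiv (open_cylinder :: ((real ^ 'm) \<times> real) set)
                       (open_slab :: ((real ^ 'm) \<times> real) set)"
proof -
  \<comment> \<open>The ambient dimension is \<open>CARD('m) + 1\<close>, so the ball factor has
    dimension at least 2.\<close>
  have "(open_cylinder :: ((real ^ 'm) \<times> real) set) \<Turnstile> chi"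
    using assms by (intro open_cylinder_chi) simp
  moreover note open_slab_not_chi[where 'm = 'm]
  ultimately show ?thesis
    using sentence_chi by (auto simp: elem_equiv_def models_def)
qed

end
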